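(* Let $p\geq 3$ be a prime. Then the clique number of the weakly nil clean graph $G_{WN}(\mathbb{Z}_p)$ of the field $\mathbb{Z}_p$ is $3$.
   Context: $\mathbb{Z}_p$ is the ring of integers modulo $p$. For a ring $R$, $Idem(R)$ is the set of idempotents and $Nil(R)$ the set of nilpotent elements of $R$. An element $x\in R$ is weakly nil clean if $x=n+e$ or $x=n-e$ for some $e\in Idem(R)$ and $n\in Nil(R)$. The weakly nil clean graph $G_{WN}(R)$ is the simple undirected graph (no loops) with vertex set $R$, in which two distinct vertices $x,y$ are adjacent if and only if $x+y$ is a weakly nil clean element of $R$. The clique number of a graph is the number of vertices in a maximum clique, i.e. a largest set of pairwise adjacent vertices. *)

theory Defs
  imports "HOL-Number_Theory.Residues"
begin

definition idempotents :: "('a, 'b) ring_scheme \<Rightarrow> 'a set" where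
  "idempotents R = {e \<in> carrier R. e \<otimes>\<^bsub>R\<^esub> e = e}"

definition nilpotents :: "('a, 'b) ring_scheme \<Rightarrow> 'a set" where
  "nilpotents R = {n \<in> carrier R. \<exists>k::nat. k \<ge> 1 \<and> n [^]\<^bsub>R\<^esub> k = \<zero>\<^bsub>R\<^esub>}"

definition weakly_nil_clean :: "('a, 'b) ring_scheme \<Rightarrow> 'a \<Rightarrow> bool" where
  "weakly_nil_clean R x \<longleftrightarrow>
     x \<in> carrier R \<and>
     (\<exists>n \<in> nilpotents R. \<exists>e \<in> idempotents R. x = n \<oplus>\<^bsub>R\<^esub> e \<or> x = n \<ominus>\<^bsub>R\<^esub> e)"

text \<open>A simple undirected graph is a pair of a vertex set and a set of edges, an edge being a
  two-element set of vertices.\<close>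

type_synonym 'a ugraph = "'a set \<times> 'a set set"

definition weakly_nil_clean_graph :: "('a, 'b) ring_scheme \<Rightarrow> 'a ugraph" where
  "weakly_nil_clean_graph R =
     (carrier R,
      {{x, y} | x y. x \<in> carrier R \<and> y \<in> carrier R \<and> x \<noteq> y \<and> weakly_nil_clean R (x \<oplus>\<^bsub>R\<^esub> y)})"

definition clique :: "'a ugraph \<Rightarrow> 'a set \<Rightarrow> bool" where
  "clique G C \<longleftrightarrow> C \<subseteq> fst G \<and> (\<forall>x \<in> C. \<forall>y \<in> C. x \<noteq> y \<longrightarrow> {x, y} \<in> snd G)"

text \<open>Meaningful only for graphs with finitely many vertices, since \<^const>\<open>card\<close> is 0 on infinite
  sets and \<^const>\<open>Max\<close> is unspecified on infinite ones.\<close>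

definition clique_number :: "'a ugraph \<Rightarrow> nat" where
  "clique_number G = Max {card C | C. clique G C}"

end

theory Submission
  imports Defs
begin

text \<open>
  In an integral domain the only nilpotent is \<open>0\<close> and the only idempotents are \<open>0\<close> and \<open>1\<close>, so
  the weakly nil clean elements are exactly \<open>0\<close>, \<open>1\<close> and \<open>-1\<close>. In particular \<open>{0, 1, -1}\<close> is a
  clique of \<open>\<int>\<^sub>p\<close>, and it has three elements because \<open>p\<close> is odd.

  For the upper bound, represent the vertices by the integers \<open>0, \<dots>, p - 1\<close>. The integer sum of
  two distinct such numbers lies strictly between \<open>0\<close> and \<open>2p - 2\<close>, so if it is congruent to
  \<open>0\<close>, \<open>1\<close> or \<open>-1\<close>, it is one of the four integers \<open>1\<close>, \<open>p - 1\<close>, \<open>p\<close>, \<open>p + 1\<close>. But four vertices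
  \<open>a < b < c < d\<close> have five different pairwise sums:
  \<open>a + b < a + c < a + d < b + d < c + d\<close>. Hence no clique has four elements.
\<close>

lemma (in domain) nilpotents_eq: "nilpotents R = {\<zero>}"
proof -
  have "n = \<zero>" if "n \<in> carrier R" "n [^] k = \<zero>" for n and k :: nat
    using that by (induction k) (auto simp: integral_iff)
  moreover have "\<zero> [^] (1::nat) = \<zero>"
    by simp
  ultimately show ?thesis
    unfolding nilpotents_def by blast
qed

lemma (in domain) idempotents_eq: "idempotents R = {\<zero>, \<one>}"
proof -
  have "e = \<zero> \<or> e = \<one>" if "e \<in> carrier R" "e \<otimes> e = e" for e
    using that by (metis m_lcancel one_closed r_one)
  then show ?thesis
    by (auto simp: idempotents_def)
qed

lemma (in domain) weakly_nil_clean_iff: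
  "weakly_nil_clean R x \<longleftrightarrow> x \<in> {\<zero>, \<one>, \<ominus> \<one>}"
  by (auto simp: weakly_nil_clean_def nilpotents_eq idempotents_eq minus_eq)

lemma clique_weakly_nil_clean_graph_iff:
  assumes "cring R"
  shows "clique (weakly_nil_clean_graph R) C \<longleftrightarrow>
    C \<subseteq> carrier R \<and>
    (\<forall>x\<in>C. \<forall>y\<in>C. x \<noteq> y \<longrightarrow> weakly_nil_clean R (x \<oplus>\<^bsub>R\<^esub> y))"
proof -
  interpret cring R by fact
  \<comment> \<open>An edge \<open>{x, y}\<close> does not determine which endpoint comes first, so commutativity matters.\<close>
  have "{x, y} \<in> snd (weakly_nil_clean_graph R) \<longleftrightarrow> weakly_nil_clean R (x \<oplus>\<^bsub>R\<^esub> y)"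
    if "x \<in> carrier R" "y \<in> carrier R" "x \<noteq> y" for x y
    using that by (auto simp: weakly_nil_clean_graph_def doubleton_eq_iff a_comm)
  then show ?thesis
    by (auto simp: clique_def weakly_nil_clean_graph_def subset_iff)
qed

lemma weakly_nil_clean_residue_ring_iff:
  assumes "prime p"
  shows "weakly_nil_clean (residue_ring (int p)) x \<longleftrightarrow> x \<in> {0, 1, int p - 1}"
proof -
  interpret residues_prime p "residue_ring (int p)"
    by unfold_locales (use assms in auto)
  have "(- 1) mod int p = int p - 1"
    using p_prime prime_gt_1_nat[of p] by (simp add: zmod_minus1)
  then show ?thesis
    using p_prime prime_gt_1_nat[of p]
    by (simp add: weakly_nil_clean_iff one_cong res_neg_eq res_zero_eq)
qed

lemma clique_residue_ring_iff:
  assumes "prime p"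
  shows "clique (weakly_nil_clean_graph (residue_ring (int p))) C \<longleftrightarrow>
    C \<subseteq> {0..int p - 1} \<and>
    (\<forall>x\<in>C. \<forall>y\<in>C. x \<noteq> y \<longrightarrow> (x + y) mod int p \<in> {0, 1, int p - 1})"
proof -
  interpret residues_prime p "residue_ring (int p)"
    by unfold_locales (use assms in auto)
  show ?thesis
    by (simp add: clique_weakly_nil_clean_graph_iff[OF cring]
        weakly_nil_clean_residue_ring_iff[OF assms] res_carrier_eq res_add_eq)
qed

text \<open>
  Of the six integers below \<open>2p\<close> with an admissible residue, \<open>0\<close> and \<open>2p - 1\<close> are not sums of two
  distinct residues.
\<close>
lemma sum_of_distinct_residues_cases:
  fixes p x y :: int
  assumes "x \<in> {0..p - 1}" "y \<in> {0..p - 1}" "x \<noteq> y"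
    and "(x + y) mod p \<in> {0, 1, p - 1}"
  shows "x + y \<in> {1, p - 1, p, p + 1}"
proof (cases "x + y < p")
  case True
  then have "(x + y) mod p = x + y"
    using assms by simp
  then show ?thesis
    using assms by auto
next
  case False
  have "(x + y) mod p = (x + y - p) mod p"
    by simp
  also have "\<dots> = x + y - p"
    using False assms by (intro mod_pos_pos_trivial) auto
  finally show ?thesis
    using assms by auto
qed

lemma card_clique_residue_ring_le:
  assumes "prime p" and "clique (weakly_nil_clean_graph (residue_ring (int p))) C"
  shows "card C \<le> 3"
proof (rule ccontr)
  assume "\<not> card C \<le> 3"
  have C: "C \<subseteq> {0..int p - 1}"
    and adj: "\<And>x y. x \<in> C \<Longrightarrow> y \<in> C \<Longrightarrow> x \<noteq> y \<Longrightarrow> (x + y) mod int p \<in> {0, 1, int p - 1}"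
    using assms(2) unfolding clique_residue_ring_iff[OF assms(1)] by blast+
  have fin: "finite C"
    using C finite_subset by blast
  define xs where "xs = sorted_list_of_set C"
  have len: "length xs \<ge> 4"
    using \<open>\<not> card C \<le> 3\<close> by (simp add: xs_def)
  have mem: "xs ! i \<in> C" if "i < 4" for i
    using that len fin nth_mem[of i xs] by (simp add: xs_def)
  have less: "xs ! i < xs ! j" if "i < j" "j < 4" for i j
    using that len strict_sorted_list_of_set[of C] sorted_wrt_nth_less[of "(<)" xs i j]
    by (simp add: xs_def)
  have sums: "xs ! i + xs ! j \<in> {1, int p - 1, int p, int p + 1}" if "i < j" "j < 4" for i j
    using that mem[of i] mem[of j] less[of i j] C adj
    by (intro sum_of_distinct_residues_cases) auto
  have "xs ! 0 < xs ! 1" "xs ! 1 < xs ! 2" "xs ! 2 < xs ! 3"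
    by (simp_all add: less)
  then have "card {xs ! 0 + xs ! 1, xs ! 0 + xs ! 2, xs ! 0 + xs ! 3, xs ! 1 + xs ! 3,
    xs ! 2 + xs ! 3} = 5" (is "card ?S = 5")
    by (simp add: card_insert_if)
  moreover have "?S \<subseteq> {1, int p - 1, int p, int p + 1}"
    using sums[of 0 1] sums[of 0 2] sums[of 0 3] sums[of 1 3] sums[of 2 3]
    by (simp del: insert_iff)
  then have "card ?S \<le> card {1, int p - 1, int p, int p + 1}"
    by (intro card_mono) simp_all
  moreover have "card {1, int p - 1, int p, int p + 1} \<le> 4"
    by (simp add: card_insert_if)
  ultimately show False
    by linarith
qed

lemma clique_zero_one_minus_one:
  assumes "prime p" and "p \<ge> 3"
  shows "clique (weakly_nil_clean_graph (residue_ring (int p))) {0, 1, int p - 1}"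
  using assms by (auto simp: clique_residue_ring_iff zmod_minus1)

theorem theorem3p4:
  fixes p :: nat
  assumes "prime p" and "p \<ge> 3"
  shows "clique_number (weakly_nil_clean_graph (residue_ring (int p))) = 3"
proof -
  let ?K = "{card C | C. clique (weakly_nil_clean_graph (residue_ring (int p))) C}"
  have le: "k \<le> 3" if "k \<in> ?K" for k
    using that card_clique_residue_ring_le[OF assms(1)] by auto
  then have "finite ?K"
    by (meson finite_nat_set_iff_bounded_le)
  moreover have "card {0, 1, int p - 1} = 3"
    using assms(2) by simp
  then have "3 \<in> ?K"
    using clique_zero_one_minus_one[OF assms] by (metis (mono_tags, lifting) mem_Collect_eq)
  ultimately show ?thesis
    unfolding clique_number_def using le by (intro Max_eqI) auto
qed

end
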